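(* Let $f:\mathbb{R}^d\to\mathbb{R}$ be a differentiable convex function with unique minimizer $x^\star$. Let $K\ge1$ be an integer, $X_0\in\mathbb{R}^d$, and let $T_0=1$ and $T_1,\dots,T_K>0$ satisfy $T_k^2\ge\frac{9}{8}T_{k-1}^2$ for all $k\in\{1,\dots,K\}$. Let $X_K$ be the output of the algorithm HFA run from $X_0$ for $K$ iterations with parameter $\lambda=1$ and integration times $T_1,\dots,T_K$. Then $$f(X_K)-f(x^\star)\le\left(\frac{8}{9}\right)^K\left(f(X_0)-f(x^\star)+\frac{1}{3}\|X_0-x^\star\|^2\right).$$
   Context: The Hamiltonian flow of $f$ is the system $\dot X_t=Y_t$, $\dot Y_t=-\nabla f(X_t)$ on $\mathbb{R}^d\times\mathbb{R}^d$. Standing assumption: for every initial condition it admits a unique solution on $[0,\infty)$. Algorithm HFA (Hamiltonian Flow for optimization with Averaging). Input: $X_0\in\mathbb{R}^d$, number of iterations $K\in\mathbb{N}$, parameter $\lambda\ge0$, integration times $T_1,\dots,T_K>0$. For $k=1,\dots,K$: let $(X^{(k)}_t,Y^{(k)}_t)_{t\in[0,T_k]}$ be the Hamiltonian flow with initial condition $(X^{(k)}_0,Y^{(k)}_0)=(X_{k-1},\mathbf{0})$; compute $X^{\mathrm{avg}}(X_{k-1};T_k)=\frac{2}{T_k^2}\int_0^{T_k}(T_k-t)X^{(k)}_t\,\mathrm{d}t$; set $X_k=\frac{1}{\lambda+1}X^{\mathrm{avg}}(X_{k-1};T_k)+\frac{\lambda}{\lambda+1}X^{(k)}_{T_k}$.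 Output: $X_K$. *)

theory Defs
  imports "HOL-Analysis.Analysis"
begin

definition gradient :: "('a::real_inner \<Rightarrow> real) \<Rightarrow> 'a \<Rightarrow> 'a"
  where "gradient f x = (THE D. GDERIV f x :> D)"

lemma gradient_eqI: "GDERIV f x :> D \<Longrightarrow> gradient f x = D"
  unfolding gradient_def
proof (rule the_equality)
  fix D' assume "GDERIV f x :> D" "GDERIV f x :> D'"
  then have "(\<lambda>h. inner h D) = (\<lambda>h. inner h D')"
    unfolding gderiv_def by (rule has_derivative_unique)
  then have "inner h D' = inner h D" for h
    by (simp add: fun_eq_iff)
  then show "D' = D"
    by (metis vector_eq_rdot inner_commute)
qed

text \<open>At the left end point \<open>t = 0\<close> the derivatives are one-sided, since they are taken
  within \<open>{0..}\<close>; the values of \<open>X\<close> and \<open>Y\<close> at negative times are irrelevant.\<close>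

definition hamiltonian_solution ::
    "('a::real_inner \<Rightarrow> real) \<Rightarrow> 'a \<Rightarrow> 'a \<Rightarrow> (real \<Rightarrow> 'a) \<Rightarrow> (real \<Rightarrow> 'a) \<Rightarrow> bool"
  where "hamiltonian_solution f x0 y0 X Y \<longleftrightarrow>
    X 0 = x0 \<and> Y 0 = y0 \<and>
    (\<forall>t\<ge>0. (X has_vector_derivative Y t) (at t within {0..})) \<and>
    (\<forall>t\<ge>0. (Y has_vector_derivative - gradient f (X t)) (at t within {0..}))"

definition hamiltonian_well_posed :: "('a::real_inner \<Rightarrow> real) \<Rightarrow> bool"
  where "hamiltonian_well_posed f \<longleftrightarrow>
    (\<forall>x0 y0. (\<exists>X Y. hamiltonian_solution f x0 y0 X Y) \<and>
      (\<forall>X Y X' Y'. hamiltonian_solution f x0 y0 X Y \<longrightarrow> hamiltonian_solution f x0 y0 X' Y' \<longrightarrow>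
        (\<forall>t\<ge>0. X t = X' t \<and> Y t = Y' t)))"

text \<open>The description is applied to the state at time \<open>t\<close> and not to the solution as a function on
  \<open>real\<close>, which is only determined on \<open>{0..}\<close>. It is meaningful for \<open>t \<ge> 0\<close> and well-posed \<open>f\<close>.\<close>

definition hamiltonian_flow ::
    "('a::real_inner \<Rightarrow> real) \<Rightarrow> 'a \<times> 'a \<Rightarrow> real \<Rightarrow> 'a \<times> 'a"
  where "hamiltonian_flow f z t =
    (THE w. \<exists>X Y. hamiltonian_solution f (fst z) (snd z) X Y \<and> w = (X t, Y t))"

lemma hamiltonian_flow_eq:
  assumes "hamiltonian_well_posed f" "hamiltonian_solution f x0 y0 X Y" "t \<ge> 0"
  shows "hamiltonian_flow f (x0, y0) t = (X t, Y t)"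
  unfolding hamiltonian_flow_def fst_conv snd_conv
  using assms by (intro the_equality) (unfold hamiltonian_well_posed_def, blast+)

definition X_flow :: "('a::real_inner \<Rightarrow> real) \<Rightarrow> 'a \<Rightarrow> real \<Rightarrow> 'a"
  where "X_flow f x t = fst (hamiltonian_flow f (x, 0) t)"

definition X_avg :: "('a::euclidean_space \<Rightarrow> real) \<Rightarrow> 'a \<Rightarrow> real \<Rightarrow> 'a"
  where "X_avg f x T = (2 / T\<^sup>2) *\<^sub>R integral {0..T} (\<lambda>t. (T - t) *\<^sub>R X_flow f x t)"

text \<open>The iterate \<open>X\<^sub>k\<close>; the integration times used by the first \<open>k\<close> iterations are
  \<open>T 1, \<dots>, T k\<close>, and \<open>T 0\<close> is not used.\<close>

primrec HFA :: "('a::euclidean_space \<Rightarrow> real) \<Rightarrow> real \<Rightarrow> (nat \<Rightarrow> real) \<Rightarrow> 'a \<Rightarrow> nat \<Rightarrow> 'a"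
  where
    "HFA f lam T X0 0 = X0"
  | "HFA f lam T X0 (Suc k) =
      (1 / (lam + 1)) *\<^sub>R X_avg f (HFA f lam T X0 k) (T (Suc k)) +
      (lam / (lam + 1)) *\<^sub>R X_flow f (HFA f lam T X0 k) (T (Suc k))"

end

theory Submission
  imports Defs
begin

text \<open>Write \<open>F = f - f xstar\<close>. The proof shows that the potential
  \<open>E k = F X\<^sub>k + \<parallel>X\<^sub>k - xstar\<parallel>\<^sup>2 / (3 T\<^sub>k\<^sup>2)\<close> shrinks by the factor \<open>8/9\<close> in every iteration.

  Along a trajectory that starts at rest, energy conservation gives
  \<open>\<parallel>Y\<parallel>\<^sup>2 = 2 (F x0 - F X)\<close>, and convexity gives \<open>\<langle>\<nabla>f X, X - xstar\<rangle> \<ge> F X\<close>. Therefore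
  \<open>(\<parallel>X - xstar\<parallel>\<^sup>2)'' = 2 \<parallel>Y\<parallel>\<^sup>2 - 2 \<langle>\<nabla>f X, X - xstar\<rangle> \<le> 4 F x0 - 6 F X\<close>.
  Two integrations turn the right-hand side into an integral against the weight \<open>T - t\<close>
  (\<open>distance_virial_bound\<close>), which is exactly the weight that defines the averaged point.
  Jensen's inequality for the average then trades the integral of \<open>F X\<close> for the objective value
  at the average: a large excess there must have pulled the endpoint \<open>X T\<close> towards the
  minimizer (\<open>average_objective_bound\<close>).

  The next starting point is the midpoint of the average and the endpoint. Its objective value is
  controlled by the average, whose excess is bounded as above, and by the endpoint, whose excess is
  at most \<open>F x0\<close>; its distance to the minimizer is controlled by the endpoint, as above, and by the
  average, to which Jensen's inequality applies once more (\<open>average_distance_bound\<close>). Half of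
  everything adds up to \<open>(2/3 + 1 + 1/9) / 2 = 8/9\<close> times \<open>F x0\<close>, while the squared
  distance keeps its coefficient \<open>1 / (3 T\<^sup>2)\<close> (\<open>midpoint_contraction\<close>). The growth condition on the
  integration times multiplies this coefficient by at most \<open>8/9\<close> from one iteration to the next, so
  that the distance term contracts as well; \<open>T 0 = 1\<close> makes it \<open>1/3\<close> initially.\<close>

section \<open>Gradients of convex functions\<close>

lemma differentiable_GDERIV_gradient:
  fixes f :: "'a::euclidean_space \<Rightarrow> real"
  assumes "f differentiable at x"
  shows "GDERIV f x :> gradient f x"
proof -
  obtain f' where f': "(f has_derivative f') (at x)"
    using assms unfolding differentiable_def by blast
  have "linear f'"
    using f' by (rule has_derivative_linear)
  then have "f' = (\<lambda>h. inner h (adjoint f' 1))"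
    by (simp add: adjoint_works fun_eq_iff)
  with f' have "GDERIV f x :> adjoint f' 1"
    unfolding gderiv_def by simp
  then show ?thesis
    using gradient_eqI by metis
qed

text \<open>Restricting \<open>f\<close> to the line through \<open>x\<close> and \<open>y\<close> reduces this to the tangent inequality for
  convex functions of one real variable.\<close>

lemma convex_above_gradient:
  fixes f :: "'a::euclidean_space \<Rightarrow> real"
  assumes "convex_on UNIV f" "f differentiable at x"
  shows "f x + inner (gradient f x) (y - x) \<le> f y"
proof -
  define g where "g = (\<lambda>t::real. f (x + t *\<^sub>R (y - x)))"
  have conv: "convex_on UNIV g"
  proof (rule convex_onI)
    fix t a b :: real
    assume "0 < t" "t < 1"
    have "x + ((1 - t) *\<^sub>R a + t *\<^sub>R b) *\<^sub>R (y - x)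
        = (1 - t) *\<^sub>R (x + a *\<^sub>R (y - x)) + t *\<^sub>R (x + b *\<^sub>R (y - x))"
      by (simp add: algebra_simps)
    then show "g ((1 - t) *\<^sub>R a + t *\<^sub>R b) \<le> (1 - t) * g a + t * g b"
      using convex_onD[OF assms(1), of t] \<open>0 < t\<close> \<open>t < 1\<close> unfolding g_def
      by (metis UNIV_I less_eq_real_def)
  qed simp
  have "(f has_derivative (\<lambda>h. inner h (gradient f x))) (at (x + 0 *\<^sub>R (y - x)))"
    using differentiable_GDERIV_gradient[OF assms(2)] by (simp add: gderiv_def)
  moreover have "((\<lambda>t::real. x + t *\<^sub>R (y - x)) has_derivative (\<lambda>t. t *\<^sub>R (y - x))) (at 0)"
    by (auto intro!: derivative_eq_intros)
  ultimately have "(g has_derivative (\<lambda>t. inner (t *\<^sub>R (y - x)) (gradient f x))) (at 0)"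
    unfolding g_def using has_derivative_compose by fastforce
  then have "(g has_real_derivative inner (gradient f x) (y - x)) (at 0)"
    by (simp add: has_field_derivative_def inner_commute mult_commute_abs)
  then have "g 1 - g 0 \<ge> inner (gradient f x) (y - x) * (1 - 0)"
    by (intro convex_on_imp_above_tangent[OF conv]) (auto)
  then show ?thesis
    by (simp add: g_def)
qed

section \<open>Averages with a linearly decreasing weight\<close>

lemma triangular_weight_has_integral:
  fixes T :: real
  assumes "T \<ge> 0"
  shows "((\<lambda>t. T - t) has_integral T\<^sup>2 / 2) {0..T}"
proof -
  have "((\<lambda>t. T - t) has_integral (T * T - T\<^sup>2 / 2) - (T * 0 - 0\<^sup>2 / 2)) {0..T}"
    by (rule fundamental_theorem_of_calculus[OF assms])
      (auto intro!: derivative_eq_intros simp flip: has_real_derivative_iff_has_vector_derivative)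
  then show ?thesis
    by (simp add: power2_eq_square)
qed

lemma triangular_weight_square_has_integral:
  fixes T :: real
  assumes "T \<ge> 0"
  shows "((\<lambda>t. (T - t) * t\<^sup>2) has_integral T ^ 4 / 12) {0..T}"
proof -
  have "((\<lambda>t. (T - t) * t\<^sup>2) has_integral
      (T * T ^ 3 / 3 - T ^ 4 / 4) - (T * 0 ^ 3 / 3 - 0 ^ 4 / 4)) {0..T}"
    by (rule fundamental_theorem_of_calculus[OF assms])
      (auto intro!: derivative_eq_intros simp flip: has_real_derivative_iff_has_vector_derivative
        simp: field_simps power2_eq_square power3_eq_cube)
  then show ?thesis
    by (simp add: power4_eq_xxxx power3_eq_cube field_simps)
qed

text \<open>The weight \<open>2 (T - t) / T\<^sup>2\<close> is a probability density on \<open>{0..T}\<close> under which \<open>X\<close> has mean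
  \<open>A\<close>, so integrating the affine minorant at \<open>A\<close> along \<open>X\<close> leaves \<open>h A\<close>. The function \<open>h\<close> will be
  the objective and the squared distance to the minimizer, with their gradients as \<open>g\<close>.\<close>

lemma triangular_average_Jensen:
  fixes X :: "real \<Rightarrow> 'a::euclidean_space" and h :: "'a \<Rightarrow> real"
  assumes T: "T > 0" and X: "continuous_on {0..T} X"
    and A: "A = (2 / T\<^sup>2) *\<^sub>R integral {0..T} (\<lambda>t. (T - t) *\<^sub>R X t)"
    and h: "continuous_on {0..T} (\<lambda>t. h (X t))"
    and subgrad: "\<And>z. h A + inner g (z - A) \<le> h z"
  shows "h A \<le> 2 / T\<^sup>2 * integral {0..T} (\<lambda>t. (T - t) * h (X t))"
proof -
  note w = triangular_weight_has_integral[OF less_imp_le[OF T]]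
  have "((\<lambda>t. (T - t) *\<^sub>R X t) has_integral (T\<^sup>2 / 2) *\<^sub>R A) {0..T}"
    unfolding A using T
    by (simp add: integrable_integral integrable_continuous_interval X continuous_intros)
  from has_integral_linear[OF this bounded_linear_inner_right[of g]]
  have I: "((\<lambda>t. inner g ((T - t) *\<^sub>R X t)) has_integral inner g ((T\<^sup>2 / 2) *\<^sub>R A)) {0..T}"
    by (simp add: o_def)
  have "((\<lambda>t. (T - t) * (h A - inner g A) + inner g ((T - t) *\<^sub>R X t)) has_integral
      T\<^sup>2 / 2 * (h A - inner g A) + inner g ((T\<^sup>2 / 2) *\<^sub>R A)) {0..T}"
    by (intro has_integral_add has_integral_mult_left w I)
  moreover have "((\<lambda>t. (T - t) * h (X t)) has_integral
      integral {0..T} (\<lambda>t. (T - t) * h (X t))) {0..T}"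
    by (intro integrable_integral integrable_continuous_interval continuous_intros h)
  moreover have "(T - t) * (h A - inner g A) + inner g ((T - t) *\<^sub>R X t) \<le> (T - t) * h (X t)"
    if "t \<in> {0..T}" for t
  proof -
    have "(T - t) * (h A + inner g (X t - A)) \<le> (T - t) * h (X t)"
      using that subgrad by (intro mult_left_mono) auto
    then show ?thesis
      by (simp add: algebra_simps inner_diff_right)
  qed
  ultimately have "T\<^sup>2 / 2 * (h A - inner g A) + inner g ((T\<^sup>2 / 2) *\<^sub>R A)
      \<le> integral {0..T} (\<lambda>t. (T - t) * h (X t))"
    by (rule has_integral_le)
  then show ?thesis
    using T by (simp add: field_simps)
qed

section \<open>Trajectories that start at rest\<close>

locale rest_trajectory =
  fixes f :: "'a::euclidean_space \<Rightarrow> real" and xstar x0 :: 'a and X Y :: "real \<Rightarrow> 'a"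
  assumes differentiable: "f differentiable_on UNIV"
    and convex: "convex_on UNIV f"
    and minimum: "\<And>x. f xstar \<le> f x"
    and solution: "hamiltonian_solution f x0 0 X Y"
begin

lemma initial: "X 0 = x0" "Y 0 = 0"
  using solution by (auto simp: hamiltonian_solution_def)

lemma position_derivative:
  "S \<subseteq> {0..} \<Longrightarrow> t \<in> S \<Longrightarrow> (X has_vector_derivative Y t) (at t within S)"
  using solution by (auto simp: hamiltonian_solution_def intro: has_vector_derivative_within_subset)

lemma velocity_derivative:
  "S \<subseteq> {0..} \<Longrightarrow> t \<in> S \<Longrightarrow> (Y has_vector_derivative - gradient f (X t)) (at t within S)"
  using solution by (auto simp: hamiltonian_solution_def intro: has_vector_derivative_within_subset)

lemma continuous_position: "continuous_on {0..T} X"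
  unfolding continuous_on_eq_continuous_within
  by (auto intro!: has_vector_derivative_continuous position_derivative)

lemma continuous_objective: "continuous_on {0..T} (\<lambda>t. f (X t))"
  using continuous_on_compose2[OF differentiable_imp_continuous_on[OF differentiable]
      continuous_position] by simp

lemma gradient_inequality: "f x + inner (gradient f x) (y - x) \<le> f y"
  using convex_above_gradient[OF convex] differentiable
  by (auto simp: differentiable_on_def)

lemma energy_conservation:
  assumes "t \<ge> 0"
  shows "f (X t) + (norm (Y t))\<^sup>2 / 2 = f x0"
proof -
  define E where "E = (\<lambda>t. f (X t) + inner (Y t) (Y t) / 2)"
  have "(E has_derivative (\<lambda>h. 0)) (at s within {0..})" if "s \<in> {0..}" for s
  proof -
    have "(f has_derivative (\<lambda>h. inner h (gradient f (X s)))) (at (X s))"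
      using differentiable_GDERIV_gradient[of f "X s"] differentiable
      by (auto simp: gderiv_def differentiable_on_def)
    from has_derivative_compose[OF position_derivative[OF order_refl that,
          unfolded has_vector_derivative_def] this]
    have "((\<lambda>t. f (X t)) has_derivative (\<lambda>h. inner (h *\<^sub>R Y s) (gradient f (X s))))
        (at s within {0..})" .
    with velocity_derivative[OF order_refl that, unfolded has_vector_derivative_def]
    show ?thesis
      unfolding E_def
      by (auto intro!: derivative_eq_intros simp: fun_eq_iff inner_commute)
  qed
  then obtain c where "\<And>s. s \<in> {0..} \<Longrightarrow> E s = c"
    using has_derivative_zero_constant[of "{0..}" E] by auto
  then have "E t = E 0"
    using assms by simp
  then show ?thesis
    by (simp add: E_def initial power2_norm_eq_inner)
qed

text \<open>This is the differential inequality \<open>(\<parallel>X - xstar\<parallel>\<^sup>2)'' \<le> 4 F x0 - 6 F X\<close> of the introduction,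
  integrated twice.\<close>

lemma distance_virial_bound:
  assumes "T \<ge> 0"
  shows "(norm (X T - xstar))\<^sup>2 \<le> (norm (x0 - xstar))\<^sup>2 + 2 * T\<^sup>2 * (f x0 - f xstar)
    - 6 * integral {0..T} (\<lambda>t. (T - t) * (f (X t) - f xstar))"
proof -
  \<comment> \<open>The first-order Taylor prediction, made at time \<open>t\<close>, of the squared distance at time \<open>T\<close>: in its
    derivative the first-order terms cancel and the second derivative appears with weight \<open>T - t\<close>,
    so a single integration replaces two nested ones.\<close>
  define \<phi> where "\<phi> = (\<lambda>t. inner (X t - xstar) (X t - xstar) + 2 * (T - t) * inner (X t - xstar) (Y t))"
  define \<phi>' where "\<phi>' = (\<lambda>t. 2 * (T - t) * (inner (Y t) (Y t) - inner (X t - xstar) (gradient f (X t))))"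
  have "(\<phi> has_vector_derivative \<phi>' t) (at t within {0..T})" if "t \<in> {0..T}" for t
    unfolding \<phi>_def \<phi>'_def has_vector_derivative_def
    using position_derivative[of "{0..T}" t, unfolded has_vector_derivative_def]
      velocity_derivative[of "{0..T}" t, unfolded has_vector_derivative_def] that
    by (auto intro!: derivative_eq_intros simp: fun_eq_iff inner_commute algebra_simps)
  then have "(\<phi>' has_integral \<phi> T - \<phi> 0) {0..T}"
    using fundamental_theorem_of_calculus[OF assms] by blast
  moreover have "((\<lambda>t. (T - t) * (4 * (f x0 - f xstar)) - 6 * ((T - t) * (f (X t) - f xstar)))
      has_integral T\<^sup>2 / 2 * (4 * (f x0 - f xstar))
        - 6 * integral {0..T} (\<lambda>t. (T - t) * (f (X t) - f xstar))) {0..T}"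
    by (intro has_integral_diff has_integral_mult_left has_integral_mult_right
        triangular_weight_has_integral[OF assms] integrable_integral
        integrable_continuous_interval continuous_intros continuous_objective)
  moreover have "\<phi>' t \<le> (T - t) * (4 * (f x0 - f xstar)) - 6 * ((T - t) * (f (X t) - f xstar))"
    if "t \<in> {0..T}" for t
  proof -
    have "inner (Y t) (Y t) = 2 * (f x0 - f (X t))"
      using energy_conservation[of t] that by (simp add: power2_norm_eq_inner)
    moreover have "f (X t) - f xstar \<le> inner (X t - xstar) (gradient f (X t))"
      using gradient_inequality[of "X t" xstar]
      by (simp add: inner_diff_left inner_diff_right inner_commute)
    ultimately have "2 * (T - t) * (inner (Y t) (Y t) - inner (X t - xstar) (gradient f (X t)))
        \<le> 2 * (T - t) * (2 * (f x0 - f xstar) - 3 * (f (X t) - f xstar))"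
      using that by (intro mult_left_mono) auto
    then show ?thesis
      by (simp add: \<phi>'_def algebra_simps)
  qed
  ultimately have "\<phi> T - \<phi> 0 \<le> T\<^sup>2 / 2 * (4 * (f x0 - f xstar))
        - 6 * integral {0..T} (\<lambda>t. (T - t) * (f (X t) - f xstar))"
    by (rule has_integral_le)
  then show ?thesis
    by (simp add: \<phi>_def initial power2_norm_eq_inner algebra_simps)
qed

text \<open>Dropping the nonnegative integral gives a bound that holds uniformly in time and can itself be
  averaged.\<close>

lemma distance_quadratic_growth:
  assumes "T \<ge> 0"
  shows "(norm (X T - xstar))\<^sup>2 \<le> (norm (x0 - xstar))\<^sup>2 + 2 * T\<^sup>2 * (f x0 - f xstar)"
proof -
  have "0 \<le> integral {0..T} (\<lambda>t. (T - t) * (f (X t) - f xstar))"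
    using minimum
    by (intro integral_nonneg integrable_continuous_interval continuous_intros continuous_objective)
       auto
  with distance_virial_bound[OF assms] show ?thesis
    by linarith
qed

definition average :: "real \<Rightarrow> 'a" where
  "average T = (2 / T\<^sup>2) *\<^sub>R integral {0..T} (\<lambda>t. (T - t) *\<^sub>R X t)"

text \<open>The division by \<open>3 T\<^sup>2\<close> is dictated by the virial bound: it turns \<open>6\<close> times the
  weighted integral into the normalized average of \<open>F X\<close>, which dominates the excess at the
  averaged point.\<close>

lemma average_objective_bound:
  assumes T: "T > 0"
  shows "f (average T) - f xstar + (norm (X T - xstar))\<^sup>2 / (3 * T\<^sup>2)
    \<le> 2 / 3 * (f x0 - f xstar) + (norm (x0 - xstar))\<^sup>2 / (3 * T\<^sup>2)"
proof -
  define J where "J = integral {0..T} (\<lambda>t. (T - t) * (f (X t) - f xstar))"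
  have "f (average T) - f xstar \<le> 2 / T\<^sup>2 * J"
    unfolding J_def
    by (rule triangular_average_Jensen[OF T continuous_position average_def,
          where h = "\<lambda>z. f z - f xstar" and g = "gradient f (average T)"])
       (use gradient_inequality[of "average T"] in
         \<open>auto intro!: continuous_intros continuous_objective simp: algebra_simps\<close>)
  moreover have "(norm (X T - xstar))\<^sup>2 / (3 * T\<^sup>2)
      \<le> ((norm (x0 - xstar))\<^sup>2 + 2 * T\<^sup>2 * (f x0 - f xstar) - 6 * J) / (3 * T\<^sup>2)"
    using distance_virial_bound[of T] T by (intro divide_right_mono) (auto simp: J_def)
  moreover have "\<dots> = 2 / 3 * (f x0 - f xstar) + (norm (x0 - xstar))\<^sup>2 / (3 * T\<^sup>2) - 2 / T\<^sup>2 * J"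
    using T by (simp add: field_simps)
  ultimately show ?thesis
    by linarith
qed

text \<open>The average of \<open>t\<^sup>2\<close> under the weight is \<open>T\<^sup>2 / 6\<close>, so the quadratic growth contributes
  \<open>T\<^sup>2 / 3\<close> times \<open>F x0\<close> to the squared distance, that is \<open>1/9\<close> after division by \<open>3 T\<^sup>2\<close>.\<close>

lemma average_distance_bound:
  assumes T: "T > 0"
  shows "(norm (average T - xstar))\<^sup>2 / (3 * T\<^sup>2)
    \<le> (norm (x0 - xstar))\<^sup>2 / (3 * T\<^sup>2) + (f x0 - f xstar) / 9"
proof -
  define I where "I = integral {0..T} (\<lambda>t. (T - t) * (norm (X t - xstar))\<^sup>2)"
  have Jensen: "(norm (average T - xstar))\<^sup>2 \<le> 2 / T\<^sup>2 * I"
    unfolding I_def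
  proof (rule triangular_average_Jensen[OF T continuous_position average_def,
        where h = "\<lambda>z. (norm (z - xstar))\<^sup>2" and g = "2 *\<^sub>R (average T - xstar)"])
    show "continuous_on {0..T} (\<lambda>t. (norm (X t - xstar))\<^sup>2)"
      by (intro continuous_intros continuous_position)
    fix z
    \<comment> \<open>The gap between the squared distance and its tangent at \<open>average T\<close> is this square.\<close>
    have "0 \<le> (norm (z - average T))\<^sup>2"
      by simp
    then show "(norm (average T - xstar))\<^sup>2 + inner (2 *\<^sub>R (average T - xstar)) (z - average T)
        \<le> (norm (z - xstar))\<^sup>2"
      by (simp add: power2_norm_eq_inner inner_diff_left inner_diff_right inner_commute)
  qed
  have "I \<le> T\<^sup>2 / 2 * (norm (x0 - xstar))\<^sup>2 + T ^ 4 / 12 * (2 * (f x0 - f xstar))"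
  proof (rule has_integral_le)
    show "((\<lambda>t. (T - t) * (norm (X t - xstar))\<^sup>2) has_integral I) {0..T}"
      unfolding I_def
      by (intro integrable_integral integrable_continuous_interval continuous_intros
          continuous_position)
    show "((\<lambda>t. (T - t) * (norm (x0 - xstar))\<^sup>2 + (T - t) * t\<^sup>2 * (2 * (f x0 - f xstar)))
        has_integral T\<^sup>2 / 2 * (norm (x0 - xstar))\<^sup>2 + T ^ 4 / 12 * (2 * (f x0 - f xstar))) {0..T}"
      using T by (intro has_integral_add has_integral_mult_left triangular_weight_has_integral
          triangular_weight_square_has_integral) auto
    fix t assume t: "t \<in> {0..T}"
    then have "(T - t) * (norm (X t - xstar))\<^sup>2
        \<le> (T - t) * ((norm (x0 - xstar))\<^sup>2 + 2 * t\<^sup>2 * (f x0 - f xstar))"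
      by (intro mult_left_mono distance_quadratic_growth) auto
    then show "(T - t) * (norm (X t - xstar))\<^sup>2
        \<le> (T - t) * (norm (x0 - xstar))\<^sup>2 + (T - t) * t\<^sup>2 * (2 * (f x0 - f xstar))"
      by (simp add: algebra_simps)
  qed
  then have "2 / T\<^sup>2 * I \<le> 2 / T\<^sup>2 *
      (T\<^sup>2 / 2 * (norm (x0 - xstar))\<^sup>2 + T ^ 4 / 12 * (2 * (f x0 - f xstar)))"
    by (intro mult_left_mono) auto
  also have "\<dots> = (norm (x0 - xstar))\<^sup>2 + T\<^sup>2 / 3 * (f x0 - f xstar)"
    using T by (simp add: field_simps power2_eq_square power4_eq_xxxx)
  finally have "2 / T\<^sup>2 * I \<le> (norm (x0 - xstar))\<^sup>2 + T\<^sup>2 / 3 * (f x0 - f xstar)" .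
  with Jensen have "(norm (average T - xstar))\<^sup>2
      \<le> (norm (x0 - xstar))\<^sup>2 + T\<^sup>2 / 3 * (f x0 - f xstar)"
    by linarith
  then have "(norm (average T - xstar))\<^sup>2 / (3 * T\<^sup>2)
      \<le> ((norm (x0 - xstar))\<^sup>2 + T\<^sup>2 / 3 * (f x0 - f xstar)) / (3 * T\<^sup>2)"
    by (intro divide_right_mono) auto
  also have "\<dots> = (norm (x0 - xstar))\<^sup>2 / (3 * T\<^sup>2) + (f x0 - f xstar) / 9"
    using T by (simp add: field_simps)
  finally show ?thesis .
qed

text \<open>The halves of the bounds at the average and at the endpoint are paired crosswise: the excess at
  the average with the distance of the endpoint, and the excess at the endpoint, at most \<open>F x0\<close> by
  energy conservation, with the distance of the average.\<close>

lemma midpoint_contraction: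
  assumes T: "T > 0"
  defines "x1 \<equiv> (1 / 2) *\<^sub>R average T + (1 / 2) *\<^sub>R X T"
  shows "f x1 - f xstar + (norm (x1 - xstar))\<^sup>2 / (3 * T\<^sup>2)
    \<le> 8 / 9 * (f x0 - f xstar) + (norm (x0 - xstar))\<^sup>2 / (3 * T\<^sup>2)"
proof -
  define D where "D z = (norm (z - xstar))\<^sup>2 / (3 * T\<^sup>2)" for z
  have "f x1 \<le> f (average T) / 2 + f (X T) / 2"
    using convex_onD[OF convex, of "1 / 2" "average T" "X T"] by (simp add: x1_def)
  moreover have "f (X T) \<le> f x0"
    using energy_conservation[of T] T zero_le_power2[of "norm (Y T)"] by linarith
  moreover have "D x1 \<le> (D (average T) + D (X T)) / 2"
  proof -
    have "x1 - xstar = (1 / 2) *\<^sub>R ((average T - xstar) + (X T - xstar))"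
      by (simp add: x1_def algebra_simps flip: scaleR_left.add)
    then have "(norm (x1 - xstar))\<^sup>2 = (norm ((average T - xstar) + (X T - xstar)))\<^sup>2 / 4"
      by (simp add: power_divide)
    moreover have "(norm ((average T - xstar) + (X T - xstar)))\<^sup>2
        + (norm ((average T - xstar) - (X T - xstar)))\<^sup>2
        = 2 * (norm (average T - xstar))\<^sup>2 + 2 * (norm (X T - xstar))\<^sup>2"
      by (simp only: power2_norm_eq_inner inner_add_left inner_add_right inner_diff_left
          inner_diff_right) simp
    ultimately have "(norm (x1 - xstar))\<^sup>2
        \<le> (norm (average T - xstar))\<^sup>2 / 2 + (norm (X T - xstar))\<^sup>2 / 2"
      using zero_le_power2[of "norm ((average T - xstar) - (X T - xstar))"] by linarith
    from divide_right_mono[OF this, of "3 * T\<^sup>2"] show ?thesis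
      by (simp add: D_def add_divide_distrib)
  qed
  ultimately have "f x1 - f xstar + D x1 \<le> 8 / 9 * (f x0 - f xstar) + D x0"
    using average_objective_bound[OF T] average_distance_bound[OF T]
    unfolding D_def[symmetric] by (simp add: field_simps)
  then show ?thesis
    by (simp add: D_def)
qed

end

section \<open>Convergence of the algorithm\<close>

lemma HFA_step_contraction:
  fixes f :: "'a::euclidean_space \<Rightarrow> real" and xstar X0 :: 'a
  assumes wp: "hamiltonian_well_posed f"
    and "f differentiable_on UNIV" "convex_on UNIV f" "\<And>x. f xstar \<le> f x"
    and T: "T (Suc k) > 0"
  defines "x \<equiv> HFA f 1 T X0 k" and "x' \<equiv> HFA f 1 T X0 (Suc k)"
  shows "f x' - f xstar + (norm (x' - xstar))\<^sup>2 / (3 * (T (Suc k))\<^sup>2)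
    \<le> 8 / 9 * (f x - f xstar) + (norm (x - xstar))\<^sup>2 / (3 * (T (Suc k))\<^sup>2)"
proof -
  obtain X Y where sol: "hamiltonian_solution f x 0 X Y"
    using wp unfolding hamiltonian_well_posed_def by blast
  interpret rest_trajectory f xstar x X Y
    by unfold_locales (use assms sol in auto)
  have flow: "X_flow f x t = X t" if "t \<ge> 0" for t
    using hamiltonian_flow_eq[OF wp sol that] by (simp add: X_flow_def)
  have "integral {0..T (Suc k)} (\<lambda>t. (T (Suc k) - t) *\<^sub>R X_flow f x t)
      = integral {0..T (Suc k)} (\<lambda>t. (T (Suc k) - t) *\<^sub>R X t)"
    by (rule integral_cong) (simp add: flow)
  then have "x' = (1 / 2) *\<^sub>R average (T (Suc k)) + (1 / 2) *\<^sub>R X (T (Suc k))"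
    using T by (simp add: x'_def X_avg_def average_def flow flip: x_def)
  with midpoint_contraction[OF T] show ?thesis
    by simp
qed

theorem theorem2:
  fixes f :: "'a::euclidean_space \<Rightarrow> real" and xstar X0 :: 'a
    and K :: nat and T :: "nat \<Rightarrow> real"
  assumes "hamiltonian_well_posed f"
    and "f differentiable_on UNIV"
    and "convex_on UNIV f"
    and "\<forall>x. is_arg_min f (\<lambda>_. True) x \<longleftrightarrow> x = xstar"
    and "K \<ge> 1"
    and "T 0 = 1"
    and "\<forall>k\<in>{1..K}. T k > 0"
    and "\<forall>k\<in>{1..K}. (T k)\<^sup>2 \<ge> 9 / 8 * (T (k - 1))\<^sup>2"
  shows "f (HFA f 1 T X0 K) - f xstar
    \<le> (8 / 9) ^ K * (f X0 - f xstar + 1 / 3 * (norm (X0 - xstar))\<^sup>2)"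
proof -
  have minimum: "f xstar \<le> f x" for x
    using assms(4) by (auto simp: is_arg_min_linorder)
  define E where "E k = f (HFA f 1 T X0 k) - f xstar
    + (norm (HFA f 1 T X0 k - xstar))\<^sup>2 / (3 * (T k)\<^sup>2)" for k
  have "E k \<le> (8 / 9) ^ k * E 0" if "k \<le> K" for k
    using that
  proof (induction k)
    case (Suc k)
    have T: "T (Suc k) > 0" "9 / 8 * (T k)\<^sup>2 \<le> (T (Suc k))\<^sup>2"
      using assms(7,8) Suc.prems by force+
    have "T k > 0"
      using assms(6,7) Suc.prems by (cases k) auto
    \<comment> \<open>The step bound has the coefficient of the new integration time; the growth condition converts
      it into \<open>8/9\<close> of the old one.\<close>
    then have "(norm (HFA f 1 T X0 k - xstar))\<^sup>2 / (3 * (T (Suc k))\<^sup>2)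
        \<le> (norm (HFA f 1 T X0 k - xstar))\<^sup>2 / (3 * (9 / 8 * (T k)\<^sup>2))"
      using T by (intro divide_left_mono mult_pos_pos) auto
    then have "E (Suc k) \<le> 8 / 9 * E k"
      using HFA_step_contraction[where T = T and k = k and ?X0.0 = X0, OF assms(1-3) minimum T(1)]
      unfolding E_def by (simp add: field_simps)
    then show ?case
      using Suc by simp
  qed simp
  from this[OF order_refl] have "E K \<le> (8 / 9) ^ K * E 0" .
  moreover have "f (HFA f 1 T X0 K) - f xstar \<le> E K"
    by (simp add: E_def)
  moreover have "E 0 = f X0 - f xstar + 1 / 3 * (norm (X0 - xstar))\<^sup>2"
    by (simp add: E_def assms(6))
  ultimately show ?thesis
    by simp
qed

end
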